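(* Let $n\geq 4$. Consider $VP_n$ as a subgroup of $VP_{n+1}$ by adding a trivial strand at the end (that is, via $\lambda_{ij}\mapsto\lambda_{ij}$ for $1\le i\neq j\le n$). Then $$\mathcal{R}^V(n)\cup\bigcup_{i=0}^{n-1}s_i(\mathcal{R}^V(n))$$ is a full set of defining relations for $VP_{n+1}$ on the generators $\lambda_{ij}$, $1\le i\ne j\le n+1$.
   Context: The virtual pure braid group $VP_n$ ($n\ge 2$) is the group with generators $\lambda_{ij}$, $1\le i\neq j\le n$, and relations $\lambda_{ij}\lambda_{kl}=\lambda_{kl}\lambda_{ij}$ and $\lambda_{ki}\lambda_{kj}\lambda_{ij}=\lambda_{ij}\lambda_{kj}\lambda_{ki}$, where distinct letters stand for distinct indices. The set of all these relations is denoted $\mathcal{R}^V(n)$. For $1\le i\le n$ the degeneracy homomorphism $s_{i-1}\colon VP_n\to VP_{n+1}$ (doubling the $i$-th strand) is given on generators, for $1\le k<l\le n$, by: $s_{i-1}(\lambda_{k,l})=\lambda_{k+1,l+1}$ if $i<k$; $\lambda_{k,l+1}\lambda_{k+1,l+1}$ if $i=k$; $\lambda_{k,l+1}$ if $k<i<l$; $\lambda_{k,l+1}\lambda_{k,l}$ if $i=l$; $\lambda_{k,l}$ if $i>l$; $s_{i-1}(\lambda_{l,k})=\lambda_{l+1,k+1}$ if $i<k$; $\lambda_{l+1,k+1}\lambda_{l+1,k}$ if $i=k$; $\lambda_{l+1,k}$ if $k<i<l$; $\lambda_{l,k}\lambda_{l+1,k}$ if $i=l$; $\lambda_{l,k}$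 if $i>l$. $s_t(\mathcal{R}^V(n))$ denotes the set of relations, between words in the generators $\lambda_{ij}$ ($1\le i\ne j\le n+1$), obtained by applying $s_t$ (through the formulas above) to each letter in both sides of every relation of $\mathcal{R}^V(n)$. *)

theory Defs
  imports "HOL-Algebra.Generated_Groups"
begin

section \<open>Groups given by generators and relations\<close>

text \<open>The letter \<open>(x, True)\<close> is the generator \<open>x\<close>, the letter \<open>(x, False)\<close> its formal inverse.
  A relation \<open>u = v\<close> is the pair \<open>(u, v)\<close>.\<close>

type_synonym 'a word = "('a \<times> bool) list"
type_synonym 'a relation = "'a word \<times> 'a word"

definition words :: "'a set \<Rightarrow> 'a word set" where
  "words X = lists (X \<times> UNIV)"

definition inv_word :: "'a word \<Rightarrow> 'a word" where
  "inv_word w = map (\<lambda>(x, b). (x, \<not> b)) (rev w)"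

text \<open>\<open>consequence X R u v\<close>: the equation \<open>u = v\<close> between words over \<open>X\<close> follows from the
  relations in \<open>R\<close> and the group laws. Equivalently, \<open>u v\<^sup>-\<^sup>1\<close> represents an element of the normal
  closure of the relators of \<open>R\<close> in the free group on \<open>X\<close>.\<close>

inductive consequence :: "'a set \<Rightarrow> 'a relation set \<Rightarrow> 'a word \<Rightarrow> 'a word \<Rightarrow> bool"
  for X :: "'a set" and R :: "'a relation set" where
  refl: "u \<in> words X \<Longrightarrow> consequence X R u u"
| sym: "consequence X R u v \<Longrightarrow> consequence X R v u"
| trans: "consequence X R u v \<Longrightarrow> consequence X R v w \<Longrightarrow> consequence X R u w"
| mult: "consequence X R u u' \<Longrightarrow> consequence X R v v' \<Longrightarrow> consequence X R (u @ v) (u' @ v')"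
| cancel: "x \<in> X \<Longrightarrow> consequence X R [(x, b), (x, \<not> b)] []"
| rel: "(u, v) \<in> R \<Longrightarrow> u \<in> words X \<Longrightarrow> v \<in> words X \<Longrightarrow> consequence X R u v"

definition word_class :: "'a set \<Rightarrow> 'a relation set \<Rightarrow> 'a word \<Rightarrow> 'a word set" where
  "word_class X R u = {v. consequence X R u v}"

definition presented_group :: "'a set \<Rightarrow> 'a relation set \<Rightarrow> 'a word set monoid" where
  "presented_group X R =
     \<lparr>carrier = word_class X R ` words X,
      mult = (\<lambda>A B. {w. \<exists>u\<in>A. \<exists>v\<in>B. consequence X R (u @ v) w}),
      one = word_class X R []\<rparr>"

primrec word_value :: "('g, 'm) monoid_scheme \<Rightarrow> ('a \<Rightarrow> 'g) \<Rightarrow> 'a word \<Rightarrow> 'g" where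
  "word_value G g [] = \<one>\<^bsub>G\<^esub>"
| "word_value G g (p # w) =
     (if snd p then g (fst p) else inv\<^bsub>G\<^esub> (g (fst p))) \<otimes>\<^bsub>G\<^esub> word_value G g w"

text \<open>\<open>R\<close> is a full set of defining relations for \<open>G\<close> on the generators \<open>g x\<close>, \<open>x \<in> X\<close>.\<close>

definition full_defining_relations ::
    "('g, 'm) monoid_scheme \<Rightarrow> 'a set \<Rightarrow> ('a \<Rightarrow> 'g) \<Rightarrow> 'a relation set \<Rightarrow> bool" where
  "full_defining_relations G X g R \<longleftrightarrow>
     group G \<and> g \<in> X \<rightarrow> carrier G \<and> generate G (g ` X) = carrier G \<and>
     R \<subseteq> words X \<times> words X \<and>
     (\<forall>u\<in>words X. \<forall>v\<in>words X.
        word_value G g u = word_value G g v \<longleftrightarrow> consequence X R u v)"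

lemma words_Nil [simp]: "[] \<in> words X"
  and words_append [simp]: "u @ v \<in> words X \<longleftrightarrow> u \<in> words X \<and> v \<in> words X"
  and words_Cons [simp]: "p # w \<in> words X \<longleftrightarrow> fst p \<in> X \<and> w \<in> words X"
  by (auto simp: words_def mem_Times_iff)

lemma inv_word_in_words [simp]: "w \<in> words X \<Longrightarrow> inv_word w \<in> words X"
  by (induction w) (auto simp: inv_word_def)

lemma consequence_words:
  "consequence X R u v \<Longrightarrow> u \<in> words X \<and> v \<in> words X"
  by (induction rule: consequence.induct) auto

lemma word_class_eq_iff:
  assumes "u \<in> words X" "v \<in> words X"
  shows "word_class X R u = word_class X R v \<longleftrightarrow> consequence X R u v"
  using assms unfolding word_class_def
  by (auto intro: consequence.intros)

lemma word_class_mult: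
  assumes "u \<in> words X" "v \<in> words X"
  shows "word_class X R u \<otimes>\<^bsub>presented_group X R\<^esub> word_class X R v = word_class X R (u @ v)"
proof (intro Set.set_eqI iffI)
  fix w assume "w \<in> word_class X R u \<otimes>\<^bsub>presented_group X R\<^esub> word_class X R v"
  then obtain u' v' where "consequence X R u u'" "consequence X R v v'"
    "consequence X R (u' @ v') w"
    by (auto simp: presented_group_def word_class_def)
  then show "w \<in> word_class X R (u @ v)"
    unfolding word_class_def by (blast intro: consequence.mult consequence.trans)
next
  fix w assume "w \<in> word_class X R (u @ v)"
  then show "w \<in> word_class X R u \<otimes>\<^bsub>presented_group X R\<^esub> word_class X R v"
    using assms by (auto simp: presented_group_def word_class_def intro: consequence.refl)
qed

lemma carrier_presented_group:
  "carrier (presented_group X R) = word_class X R ` words X"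
  and one_presented_group: "\<one>\<^bsub>presented_group X R\<^esub> = word_class X R []"
  by (auto simp: presented_group_def)

lemma inv_word_cancel: "w \<in> words X \<Longrightarrow> consequence X R (inv_word w @ w) []"
proof (induction w)
  case Nil
  then show ?case by (simp add: inv_word_def consequence.refl)
next
  case (Cons p w)
  obtain x b where p: "p = (x, b)" by (cases p)
  have w: "x \<in> X" "w \<in> words X" using Cons.prems p by auto
  have "consequence X R [(x, \<not> b), (x, \<not> \<not> b)] []"
    using w by (intro consequence.cancel)
  then have "consequence X R (inv_word w @ ([(x, \<not> b), (x, b)] @ w)) (inv_word w @ ([] @ w))"
    using w by (intro consequence.mult consequence.refl) auto
  then show ?case
    using Cons.IH[OF w(2)] p
    by (auto simp: inv_word_def intro: consequence.trans)
qed

lemma group_presented_group: "group (presented_group X R)"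
proof (rule groupI)
  fix A B assume "A \<in> carrier (presented_group X R)" "B \<in> carrier (presented_group X R)"
  then show "A \<otimes>\<^bsub>presented_group X R\<^esub> B \<in> carrier (presented_group X R)"
    by (auto simp: carrier_presented_group word_class_mult)
next
  fix A assume "A \<in> carrier (presented_group X R)"
  then obtain u where u: "u \<in> words X" "A = word_class X R u"
    by (auto simp: carrier_presented_group)
  then have "word_class X R (inv_word u) \<otimes>\<^bsub>presented_group X R\<^esub> A = \<one>\<^bsub>presented_group X R\<^esub>"
    by (simp add: word_class_mult one_presented_group word_class_eq_iff inv_word_cancel)
  then show "\<exists>B\<in>carrier (presented_group X R).
      B \<otimes>\<^bsub>presented_group X R\<^esub> A = \<one>\<^bsub>presented_group X R\<^esub>"
    using u by (auto simp: carrier_presented_group)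
qed (auto simp: carrier_presented_group one_presented_group word_class_mult)


section \<open>The virtual pure braid groups\<close>

definition vp_gens :: "nat \<Rightarrow> (nat \<times> nat) set" where
  "vp_gens n = {(i, j). i \<in> {1..n} \<and> j \<in> {1..n} \<and> i \<noteq> j}"

abbreviation lam :: "nat \<Rightarrow> nat \<Rightarrow> (nat \<times> nat) \<times> bool" where
  "lam i j \<equiv> ((i, j), True)"

text \<open>A generator has the same name \<open>lam i j\<close> for all \<open>n\<close>, so the map
  \<open>VP\<^sub>n \<rightarrow> VP\<^sub>n\<^sub>+\<^sub>1\<close> that adds a trivial strand at the end does not change words or relations.\<close>

definition vp_rels :: "nat \<Rightarrow> (nat \<times> nat) relation set" where
  "vp_rels n =
     {([lam i j, lam k l], [lam k l, lam i j]) | i j k l.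
        {i, j, k, l} \<subseteq> {1..n} \<and> distinct [i, j, k, l]} \<union>
     {([lam k i, lam k j, lam i j], [lam i j, lam k j, lam k i]) | i j k.
        {i, j, k} \<subseteq> {1..n} \<and> distinct [i, j, k]}"

definition VP :: "nat \<Rightarrow> (nat \<times> nat) word set monoid" where
  "VP n = presented_group (vp_gens n) (vp_rels n)"

definition vp_gen :: "nat \<Rightarrow> nat \<times> nat \<Rightarrow> (nat \<times> nat) word set" where
  "vp_gen n x = word_class (vp_gens n) (vp_rels n) [(x, True)]"

text \<open>\<open>double_gen i (a, b)\<close> is the image of \<open>\<lambda>\<^sub>a\<^sub>b\<close> under the doubling of the \<open>i\<close>-th strand
  (strands are counted from 1).\<close>

fun double_gen :: "nat \<Rightarrow> nat \<times> nat \<Rightarrow> (nat \<times> nat) word" where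
  "double_gen i (a, b) =
     (if a < b then
        (let k = a; l = b in
         if i < k then [lam (k + 1) (l + 1)]
         else if i = k then [lam k (l + 1), lam (k + 1) (l + 1)]
         else if i < l then [lam k (l + 1)]
         else if i = l then [lam k (l + 1), lam k l]
         else [lam k l])
      else
        (let k = b; l = a in
         if i < k then [lam (l + 1) (k + 1)]
         else if i = k then [lam (l + 1) (k + 1), lam (l + 1) k]
         else if i < l then [lam (l + 1) k]
         else if i = l then [lam l k, lam (l + 1) k]
         else [lam l k]))"

text \<open>The degeneracy \<open>s\<^sub>t\<close> doubles strand \<open>t + 1\<close>.\<close>

definition degen_word :: "nat \<Rightarrow> (nat \<times> nat) word \<Rightarrow> (nat \<times> nat) word" where
  "degen_word t w = concat (map (\<lambda>(x, b).
     if b then double_gen (t + 1) x else inv_word (double_gen (t + 1) x)) w)"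

definition degen_rels ::
    "nat \<Rightarrow> (nat \<times> nat) relation set \<Rightarrow> (nat \<times> nat) relation set" where
  "degen_rels t R = (\<lambda>(u, v). (degen_word t u, degen_word t v)) ` R"

lemma vp_relsE [consumes 1, case_names commute braid]:
  assumes "r \<in> vp_rels n"
  obtains i j k l where "fst r = [lam i j, lam k l]" "snd r = [lam k l, lam i j]"
      "{i, j, k, l} \<subseteq> {1..n}" "distinct [i, j, k, l]"
  | i j k where "fst r = [lam k i, lam k j, lam i j]" "snd r = [lam i j, lam k j, lam k i]"
      "{i, j, k} \<subseteq> {1..n}" "distinct [i, j, k]"
  using assms unfolding vp_rels_def by (elim UnE CollectE exE conjE) simp_all

lemma vp_rels_commute:
  "{i, j, k, l} \<subseteq> {1..n} \<Longrightarrow> distinct [i, j, k, l] \<Longrightarrow>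
     ([lam i j, lam k l], [lam k l, lam i j]) \<in> vp_rels n"
  unfolding vp_rels_def by blast

lemma vp_rels_braid:
  "{i, j, k} \<subseteq> {1..n} \<Longrightarrow> distinct [i, j, k] \<Longrightarrow>
     ([lam k i, lam k j, lam i j], [lam i j, lam k j, lam k i]) \<in> vp_rels n"
  unfolding vp_rels_def by blast

lemma vp_gens_mono: "n \<le> m \<Longrightarrow> vp_gens n \<subseteq> vp_gens m"
  and vp_rels_mono: "n \<le> m \<Longrightarrow> vp_rels n \<subseteq> vp_rels m"
  unfolding vp_gens_def vp_rels_def by fastforce+

lemma words_mono: "X \<subseteq> Y \<Longrightarrow> words X \<subseteq> words Y"
  by (fastforce simp: words_def)

lemma consequence_mono:
  "consequence X R u v \<Longrightarrow> X \<subseteq> Y \<Longrightarrow> R \<subseteq> S \<Longrightarrow> consequence Y S u v"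
  by (induction rule: consequence.induct) (blast dest: words_mono intro: consequence.intros)+

text \<open>Forgetting all letters that involve a strand beyond \<open>n\<close> respects the relations.\<close>

lemma consequence_forget:
  assumes "consequence (vp_gens m) (vp_rels m) u v"
  shows "consequence (vp_gens n) (vp_rels n)
    (filter (\<lambda>p. fst p \<in> vp_gens n) u) (filter (\<lambda>p. fst p \<in> vp_gens n) v)"
  using assms
proof (induction rule: consequence.induct)
  case (refl u)
  have "filter (\<lambda>p. fst p \<in> vp_gens n) u \<in> words (vp_gens n)" by (induction u) auto
  then show ?case by (rule consequence.refl)
next
  case (rel u v)
  show ?case
  proof (cases "filter (\<lambda>p. fst p \<in> vp_gens n) u = filter (\<lambda>p. fst p \<in> vp_gens n) v")
    case True
    have "filter (\<lambda>p. fst p \<in> vp_gens n) v \<in> words (vp_gens n)" by (induction v) auto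
    with True show ?thesis by (simp add: consequence.refl)
  next
    case False
    have *: "(u, v) \<in> vp_rels n \<and> u \<in> words (vp_gens n) \<and> v \<in> words (vp_gens n)"
      using rel(1)
    proof (cases rule: vp_relsE)
      case (commute i j k l)
      from False have "(i, j) \<in> vp_gens n" "(k, l) \<in> vp_gens n"
        unfolding commute(1,2)[unfolded fst_conv snd_conv] by (simp_all split: if_splits)
      then have "{i, j, k, l} \<subseteq> {1..n}" by (auto simp: vp_gens_def)
      with commute(4) show ?thesis
        unfolding commute(1,2)[unfolded fst_conv snd_conv] by (simp add: vp_gens_def vp_rels_commute)
    next
      case (braid i j k)
      have "(k, i) \<in> vp_gens n \<and> (k, j) \<in> vp_gens n \<or> (k, i) \<in> vp_gens n \<and> (i, j) \<in> vp_gens n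
          \<or> (k, j) \<in> vp_gens n \<and> (i, j) \<in> vp_gens n"
        using False unfolding braid(1,2)[unfolded fst_conv snd_conv] by (simp split: if_splits)
      then have "{i, j, k} \<subseteq> {1..n}" by (auto simp: vp_gens_def)
      with braid(3-) show ?thesis
        unfolding braid(1,2)[unfolded fst_conv snd_conv] by (simp add: vp_gens_def vp_rels_braid)
    qed
    have "filter (\<lambda>p. fst p \<in> vp_gens n) w = w" if "w \<in> words (vp_gens n)" for w
      using that by (induction w) auto
    with * show ?thesis by (simp add: consequence.rel)
  qed
qed (auto intro: consequence.intros)

text \<open>Consequently, adding a trivial strand at the end embeds \<open>VP\<^sub>n\<close> into \<open>VP\<^sub>m\<close>
  for \<open>n \<le> m\<close>.\<close>

lemma vp_trivial_strand_embedding: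
  assumes "n \<le> m" "u \<in> words (vp_gens n)" "v \<in> words (vp_gens n)"
  shows "consequence (vp_gens m) (vp_rels m) u v \<longleftrightarrow> consequence (vp_gens n) (vp_rels n) u v"
proof -
  have "filter (\<lambda>p. fst p \<in> vp_gens n) w = w" if "w \<in> words (vp_gens n)" for w
    using that by (induction w) auto
  then show ?thesis
    using consequence_forget[of m u v n] assms
    by (metis consequence_mono vp_gens_mono vp_rels_mono)
qed

end

theory Submission
  imports Defs
begin

text \<open>
  A set of relations is a full set of defining relations for a presented group as soon as it has
  the same models: the assignments of group elements to the generators under which all relations
  hold. So it is enough to compare, for an arbitrary assignment \<open>g\<close> on the generators
  \<open>\<lambda>\<^sub>i\<^sub>j\<close> of \<open>VP\<^sub>n\<^sub>+\<^sub>1\<close>, the relations of \<open>VP\<^sub>n\<^sub>+\<^sub>1\<close> with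
  those in the theorem, and this replaces words by calculations in one group.

  Doubling strand \<open>p\<close> is uniform in the order of the indices. Let \<open>\<kappa>\<close> and
  \<open>\<sigma>\<close> be the increasing injections of \<open>{1..n}\<close> into \<open>{1..n+1}\<close> that omit
  \<open>p + 1\<close> and \<open>p\<close>. They differ only in that \<open>p\<close> goes to \<open>p\<close> and to
  \<open>p + 1\<close>, and the image of a generator is the product of its two relabellings by
  \<open>\<kappa>\<close> and \<open>\<sigma>\<close> (in an order that depends on whether \<open>p\<close> is the first or the
  second index), or their common value if \<open>p\<close> is no index of it. Consider a relation of
  \<open>VP\<^sub>n\<close>. If its relabelling by \<open>\<kappa>\<close> holds, then the doubled relation is equivalent to its
  relabelling by \<open>\<sigma>\<close>, by cancellation; for a braid relation this uses commutations between
  letters that involve \<open>p\<close> and letters that involve \<open>p + 1\<close> (lemmas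
  \<open>doubled_commuting_iff\<close> and \<open>doubled_braiding_iff\<close>).

  Therefore the doubled relations hold in \<open>VP\<^sub>n\<^sub>+\<^sub>1\<close>. Conversely, they allow one to replace an
  index \<open>p\<close> in a known relation by \<open>p + 1\<close> if \<open>p + 1\<close> does not occur in it. A relation has at
  most four indices, and \<open>4 < n + 1\<close>, so some index is always free. Hence every relation is
  reached by such moves from a relation of \<open>VP\<^sub>n\<close> (lemma \<open>distinct_list_shift_induct\<close>). This is
  where \<open>n \<ge> 4\<close> enters. All commutations are obtained first, as the moves for braid
  relations need them.
\<close>

section \<open>Presentations with the same models\<close>

definition models :: "('g, 'm) monoid_scheme \<Rightarrow> ('a \<Rightarrow> 'g) \<Rightarrow> 'a relation set \<Rightarrow> bool" where
  "models G g R \<longleftrightarrow> (\<forall>(u, v)\<in>R. word_value G g u = word_value G g v)"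

lemma models_Un: "models G g (R \<union> S) \<longleftrightarrow> models G g R \<and> models G g S"
  and models_UN: "models G g (\<Union>i\<in>I. Q i) \<longleftrightarrow> (\<forall>i\<in>I. models G g (Q i))"
  unfolding models_def by blast+

context group
begin

lemma word_value_closed:
  assumes "g \<in> X \<rightarrow> carrier G" "u \<in> words X"
  shows "word_value G g u \<in> carrier G"
  using assms(2) by (induction u) (use assms(1) in auto)

lemma word_value_append:
  assumes "g \<in> X \<rightarrow> carrier G" "u \<in> words X" "v \<in> words X"
  shows "word_value G g (u @ v) = word_value G g u \<otimes> word_value G g v"
  using assms(2)
proof (induction u)
  case Nil
  then show ?case using word_value_closed[OF assms(1,3)] by simp
next
  case (Cons p u)
  then have "g (fst p) \<in> carrier G" "word_value G g u \<in> carrier G"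
    using assms(1) word_value_closed[OF assms(1)] by auto
  with Cons show ?case using word_value_closed[OF assms(1,3)] by (simp add: m_assoc)
qed

lemma word_value_inv_word:
  assumes "g \<in> X \<rightarrow> carrier G" "u \<in> words X"
  shows "word_value G g (inv_word u) = inv (word_value G g u)"
  using assms(2)
proof (induction u)
  case Nil
  then show ?case by (simp add: inv_word_def)
next
  case (Cons p u)
  obtain x b where p: "p = (x, b)" by (cases p)
  have x: "x \<in> X" "g x \<in> carrier G" and u: "u \<in> words X" "word_value G g u \<in> carrier G"
    using Cons.prems p assms(1) word_value_closed[OF assms(1)] by auto
  have "word_value G g (inv_word (p # u)) = word_value G g (inv_word u @ [(x, \<not> b)])"
    by (simp add: p inv_word_def)
  also have "\<dots> = inv (word_value G g u) \<otimes> (if b then inv (g x) else g x)"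
    using x u Cons.IH word_value_append[OF assms(1), of "inv_word u" "[(x, \<not> b)]"] by simp
  also have "\<dots> = inv (word_value G g (p # u))"
    using x u by (simp add: p inv_mult_group)
  finally show ?case .
qed

lemma consequence_sound:
  assumes "g \<in> X \<rightarrow> carrier G" "models G g R" "consequence X R u v"
  shows "word_value G g u = word_value G g v"
  using assms(3)
proof (induction rule: consequence.induct)
  case (mult u u' v v')
  then show ?case
    using consequence_words[OF mult.hyps(1)] consequence_words[OF mult.hyps(2)]
    by (simp add: word_value_append[OF assms(1)])
next
  case (cancel x b)
  then have "g x \<in> carrier G" using assms(1) by auto
  then show ?case by simp
next
  case (rel u v)
  then show ?case using assms(2) unfolding models_def by blast
qed simp_all

lemma word_value_in_generate:
  assumes "u \<in> words X"
  shows "word_value G g u \<in> generate G (g ` X)"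
  using assms
  by (induction u) (auto intro: generate.intros)

end

lemma word_value_presented_group:
  assumes "u \<in> words X"
  shows "word_value (presented_group X R) (\<lambda>x. word_class X R [(x, True)]) u = word_class X R u"
  using assms
proof (induction u)
  case Nil
  then show ?case by (simp add: one_presented_group)
next
  case (Cons p u)
  interpret P: group "presented_group X R" by (rule group_presented_group)
  obtain x b where p: "p = (x, b)" by (cases p)
  have x: "x \<in> X" and u: "u \<in> words X" using Cons.prems p by auto
  have "consequence X R [(x, False), (x, True)] []"
    using consequence.cancel[OF x, of R False] by simp
  then have "inv\<^bsub>presented_group X R\<^esub> word_class X R [(x, True)] = word_class X R [(x, False)]"
    using x
    by (intro P.inv_equality)
      (auto simp: word_class_mult one_presented_group word_class_eq_iff carrier_presented_group)
  then show ?case using Cons.IH x u p by (cases b) (auto simp: word_class_mult)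
qed

lemma models_presented_group:
  assumes "R \<subseteq> words X \<times> words X"
  shows "models (presented_group X R) (\<lambda>x. word_class X R [(x, True)]) R"
  unfolding models_def
proof (intro ballI, clarify)
  fix u v assume uv: "(u, v) \<in> R"
  with assms have "u \<in> words X" "v \<in> words X" by auto
  with uv show "word_value (presented_group X R) (\<lambda>x. word_class X R [(x, True)]) u =
      word_value (presented_group X R) (\<lambda>x. word_class X R [(x, True)]) v"
    by (simp add: word_value_presented_group word_class_eq_iff consequence.rel)
qed

text \<open>
  As \<open>R\<close> and \<open>S\<close> have the same models, \<open>R\<close> holds in the group presented by
  \<open>S\<close>. Soundness there turns a consequence of \<open>R\<close> into one of \<open>S\<close>, and the same
  works with \<open>R\<close> and \<open>S\<close> exchanged. Only these two groups are used, so it is enough to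
  compare models in groups of their type.
\<close>

lemma full_defining_relations_if_same_models:
  fixes R S :: "'a relation set"
  assumes R: "R \<subseteq> words X \<times> words X" and S: "S \<subseteq> words X \<times> words X"
    and same: "\<And>(G :: 'a word set monoid) g. group G \<Longrightarrow> g \<in> X \<rightarrow> carrier G \<Longrightarrow>
      models G g R \<longleftrightarrow> models G g S"
  shows "full_defining_relations (presented_group X R) X (\<lambda>x. word_class X R [(x, True)]) S"
proof -
  have gens: "(\<lambda>x. word_class X Q [(x, True)]) \<in> X \<rightarrow> carrier (presented_group X Q)"
    for Q :: "'a relation set"
    by (auto simp: carrier_presented_group)
  have transfer: "consequence X Q' u v"
    if "consequence X Q u v" "models (presented_group X Q') (\<lambda>x. word_class X Q' [(x, True)]) Q"
    for Q Q' :: "'a relation set" and u v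
    using group.consequence_sound[OF group_presented_group gens that(2,1)]
      consequence_words[OF that(1)]
    by (simp add: word_value_presented_group word_class_eq_iff)
  have "consequence X R u v \<longleftrightarrow> consequence X S u v" for u v
    using transfer same[OF group_presented_group gens] models_presented_group[OF R]
      models_presented_group[OF S]
    by metis
  moreover have "generate (presented_group X R) ((\<lambda>x. word_class X R [(x, True)]) ` X) =
      carrier (presented_group X R)"
  proof
    show "generate (presented_group X R) ((\<lambda>x. word_class X R [(x, True)]) ` X)
        \<subseteq> carrier (presented_group X R)"
      using gens by (intro group.generate_incl[OF group_presented_group]) blast
  next
    show "carrier (presented_group X R)
        \<subseteq> generate (presented_group X R) ((\<lambda>x. word_class X R [(x, True)]) ` X)"
      using group.word_value_in_generate[OF group_presented_group[of X R], of _ X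
          "\<lambda>x. word_class X R [(x, True)]"]
      by (auto simp: carrier_presented_group word_value_presented_group)
  qed
  ultimately show ?thesis
    unfolding full_defining_relations_def
    using S gens[of R] by (simp add: group_presented_group word_value_presented_group word_class_eq_iff)
qed


section \<open>The relations of the virtual pure braid group in a group\<close>

definition commuting ::
    "('g, 'm) monoid_scheme \<Rightarrow> (nat \<times> nat \<Rightarrow> 'g) \<Rightarrow> nat \<Rightarrow> nat \<Rightarrow> nat \<Rightarrow> nat \<Rightarrow> bool" where
  "commuting G g i j k l \<longleftrightarrow> g (i, j) \<otimes>\<^bsub>G\<^esub> g (k, l) = g (k, l) \<otimes>\<^bsub>G\<^esub> g (i, j)"

definition braiding ::
    "('g, 'm) monoid_scheme \<Rightarrow> (nat \<times> nat \<Rightarrow> 'g) \<Rightarrow> nat \<Rightarrow> nat \<Rightarrow> nat \<Rightarrow> bool" where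
  "braiding G g i j k \<longleftrightarrow>
     g (k, i) \<otimes>\<^bsub>G\<^esub> g (k, j) \<otimes>\<^bsub>G\<^esub> g (i, j) = g (i, j) \<otimes>\<^bsub>G\<^esub> g (k, j) \<otimes>\<^bsub>G\<^esub> g (k, i)"

lemma mem_vp_gens_iff:
  "(i, j) \<in> vp_gens n \<longleftrightarrow> i \<in> {1..n} \<and> j \<in> {1..n} \<and> i \<noteq> j"
  by (simp add: vp_gens_def)

lemma vp_rels_in_words: "vp_rels n \<subseteq> words (vp_gens n) \<times> words (vp_gens n)"
  unfolding vp_rels_def by (auto simp: mem_vp_gens_iff)

context group
begin

lemma models_vp_rels_iff:
  assumes g: "g \<in> vp_gens n \<rightarrow> carrier G"
  shows "models G g (vp_rels n) \<longleftrightarrow>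
    (\<forall>i j k l. {i, j, k, l} \<subseteq> {1..n} \<longrightarrow> distinct [i, j, k, l] \<longrightarrow> commuting G g i j k l) \<and>
    (\<forall>i j k. {i, j, k} \<subseteq> {1..n} \<longrightarrow> distinct [i, j, k] \<longrightarrow> braiding G g i j k)"
    (is "_ \<longleftrightarrow> ?C \<and> ?B")
proof -
  have closed: "g (i, j) \<in> carrier G" if "i \<in> {1..n}" "j \<in> {1..n}" "i \<noteq> j" for i j
    using g that by (auto simp: mem_vp_gens_iff Pi_iff)
  have comm_iff: "word_value G g [lam i j, lam k l] = word_value G g [lam k l, lam i j] \<longleftrightarrow>
      commuting G g i j k l"
    if "{i, j, k, l} \<subseteq> {1..n}" "distinct [i, j, k, l]" for i j k l
    using that closed[of i j] closed[of k l] by (simp add: commuting_def)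
  have braid_iff: "word_value G g [lam k i, lam k j, lam i j] =
      word_value G g [lam i j, lam k j, lam k i] \<longleftrightarrow> braiding G g i j k"
    if "{i, j, k} \<subseteq> {1..n}" "distinct [i, j, k]" for i j k
  proof -
    have "g (k, i) \<in> carrier G" "g (k, j) \<in> carrier G" "g (i, j) \<in> carrier G"
      using that by (auto intro!: closed)
    then show ?thesis by (simp add: braiding_def m_assoc)
  qed
  show ?thesis
  proof (intro iffI conjI allI impI)
    fix i j k l
    assume "models G g (vp_rels n)" and ijkl: "{i, j, k, l} \<subseteq> {1..n}" "distinct [i, j, k, l]"
    then have "word_value G g [lam i j, lam k l] = word_value G g [lam k l, lam i j]"
      using vp_rels_commute[OF ijkl] unfolding models_def by blast
    then show "commuting G g i j k l" using comm_iff[OF ijkl] by blast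
  next
    fix i j k
    assume "models G g (vp_rels n)" and ijk: "{i, j, k} \<subseteq> {1..n}" "distinct [i, j, k]"
    then have "word_value G g [lam k i, lam k j, lam i j] =
        word_value G g [lam i j, lam k j, lam k i]"
      using vp_rels_braid[OF ijk] unfolding models_def by blast
    then show "braiding G g i j k" using braid_iff[OF ijk] by blast
  next
    assume CB: "?C \<and> ?B"
    have "word_value G g (fst r) = word_value G g (snd r)" if "r \<in> vp_rels n" for r
      using that
    proof (cases rule: vp_relsE)
      case (commute i j k l)
      then show ?thesis using CB comm_iff[OF commute(3,4)] by metis
    next
      case (braid i j k)
      then show ?thesis using CB braid_iff[OF braid(3,4)] by metis
    qed
    then show "models G g (vp_rels n)" unfolding models_def by auto
  qed
qed

end


section \<open>Doubling a strand\<close>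

text \<open>
  These are the maps \<open>\<kappa>\<close> and \<open>\<sigma>\<close>: the old indices are placed among the new ones so that
  \<open>p + 1\<close>, respectively \<open>p\<close>, is omitted.
\<close>

definition keep_index :: "nat \<Rightarrow> nat \<Rightarrow> nat" where
  "keep_index p x = (if x \<le> p then x else Suc x)"

definition shift_index :: "nat \<Rightarrow> nat \<Rightarrow> nat" where
  "shift_index p x = (if x < p then x else Suc x)"

lemma keep_index_range: "x \<in> {1..n} \<Longrightarrow> keep_index p x \<in> {1..n + 1}"
  and shift_index_range: "x \<in> {1..n} \<Longrightarrow> shift_index p x \<in> {1..n + 1}"
  by (auto simp: keep_index_def shift_index_def)

lemma keep_index_eq_iff: "keep_index p x = keep_index p y \<longleftrightarrow> x = y"
  and shift_index_eq_iff: "shift_index p x = shift_index p y \<longleftrightarrow> x = y"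
  by (auto simp: keep_index_def shift_index_def)

lemma keep_index_eq_shift_index: "x \<noteq> p \<Longrightarrow> shift_index p x = keep_index p x"
  and keep_index_self: "keep_index p p = p"
  and shift_index_self: "shift_index p p = Suc p"
  by (auto simp: keep_index_def shift_index_def)

lemma keep_index_neq_shift_index:
  "x \<noteq> y \<Longrightarrow> keep_index p x \<noteq> shift_index p y"
  by (auto simp: keep_index_def shift_index_def)

lemma double_gen_eq:
  assumes "a \<noteq> b"
  shows "double_gen p (a, b) =
    (if a = p then [lam p (keep_index p b), lam (Suc p) (keep_index p b)]
     else if b = p then [lam (keep_index p a) (Suc p), lam (keep_index p a) p]
     else [lam (keep_index p a) (keep_index p b)])"
  using assms by (auto simp: keep_index_def)

lemma double_gen_in_words:
  assumes "x \<in> vp_gens n" "p \<in> {1..n}"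
  shows "double_gen p x \<in> words (vp_gens (n + 1))"
proof -
  obtain a b where x: "x = (a, b)" by (cases x)
  have "a \<in> {1..n}" "b \<in> {1..n}" "a \<noteq> b" using assms(1) x by (auto simp: mem_vp_gens_iff)
  then show ?thesis
    using assms(2) unfolding x double_gen_eq[OF \<open>a \<noteq> b\<close>]
    by (auto simp: mem_vp_gens_iff keep_index_def)
qed

lemma degen_word_Nil: "degen_word t [] = []"
  and degen_word_Cons: "degen_word t (q # w) =
    (if snd q then double_gen (t + 1) (fst q) else inv_word (double_gen (t + 1) (fst q))) @
    degen_word t w"
  by (auto simp: degen_word_def split: prod.splits)

lemma degen_word_in_words:
  assumes "w \<in> words (vp_gens n)" "t < n"
  shows "degen_word t w \<in> words (vp_gens (n + 1))"
  using assms(1)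
proof (induction w)
  case (Cons q w)
  then have "double_gen (t + 1) (fst q) \<in> words (vp_gens (n + 1))"
    using assms(2) by (intro double_gen_in_words) auto
  with Cons show ?case by (auto simp: degen_word_Cons simp del: double_gen.simps)
qed (simp add: degen_word_Nil)

lemma degen_rels_in_words:
  assumes "t < n"
  shows "degen_rels t (vp_rels n) \<subseteq> words (vp_gens (n + 1)) \<times> words (vp_gens (n + 1))"
  using vp_rels_in_words[of n] degen_word_in_words[OF _ assms]
  unfolding degen_rels_def by auto

definition doubled :: "('g, 'm) monoid_scheme \<Rightarrow> (nat \<times> nat \<Rightarrow> 'g) \<Rightarrow> nat \<Rightarrow> nat \<times> nat \<Rightarrow> 'g" where
  "doubled G g p x = word_value G g (double_gen p x)"

context group
begin

lemma word_value_degen_word: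
  assumes "g \<in> vp_gens (n + 1) \<rightarrow> carrier G" "t < n" "w \<in> words (vp_gens n)"
  shows "word_value G g (degen_word t w) = word_value G (doubled G g (t + 1)) w"
  using assms(3)
proof (induction w)
  case (Cons q w)
  then have "double_gen (t + 1) (fst q) \<in> words (vp_gens (n + 1))"
    using assms(2) by (intro double_gen_in_words) auto
  then show ?case
    using Cons degen_word_in_words[OF _ assms(2)]
    by (simp add: degen_word_Cons doubled_def word_value_append[OF assms(1)]
        word_value_inv_word[OF assms(1)] del: double_gen.simps)
qed (simp add: degen_word_Nil)

lemma models_degen_rels_iff:
  assumes "g \<in> vp_gens (n + 1) \<rightarrow> carrier G" "t < n"
  shows "models G g (degen_rels t (vp_rels n)) \<longleftrightarrow> models G (doubled G g (t + 1)) (vp_rels n)"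
proof -
  have "word_value G g (degen_word t u) = word_value G (doubled G g (t + 1)) u \<and>
      word_value G g (degen_word t v) = word_value G (doubled G g (t + 1)) v"
    if "(u, v) \<in> vp_rels n" for u v
    using that vp_rels_in_words[of n] word_value_degen_word[OF assms] by blast
  then show ?thesis unfolding models_def degen_rels_def by fastforce
qed

lemma doubled_closed:
  assumes "g \<in> vp_gens (n + 1) \<rightarrow> carrier G" "p \<in> {1..n}"
  shows "doubled G g p \<in> vp_gens n \<rightarrow> carrier G"
  using word_value_closed[OF assms(1) double_gen_in_words[OF _ assms(2)]]
  by (auto simp: doubled_def simp del: double_gen.simps)

lemma relabelled_closed:
  assumes "g \<in> vp_gens (n + 1) \<rightarrow> carrier G" "a \<in> {1..n}" "b \<in> {1..n}" "a \<noteq> b"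
  shows "g (keep_index p a, keep_index p b) \<in> carrier G"
    and "g (shift_index p a, shift_index p b) \<in> carrier G"
proof -
  have "(keep_index p a, keep_index p b) \<in> vp_gens (n + 1)"
    "(shift_index p a, shift_index p b) \<in> vp_gens (n + 1)"
    unfolding mem_vp_gens_iff keep_index_eq_iff shift_index_eq_iff
    using assms(2-4) by (blast intro: keep_index_range shift_index_range)+
  then show "g (keep_index p a, keep_index p b) \<in> carrier G"
    "g (shift_index p a, shift_index p b) \<in> carrier G"
    using assms(1) by (blast dest: funcset_mem)+
qed

lemma doubled_eq:
  assumes "g \<in> vp_gens (n + 1) \<rightarrow> carrier G" "p \<in> {1..n}"
    and "a \<in> {1..n}" "b \<in> {1..n}" "a \<noteq> b"
  shows "doubled G g p (a, b) =
    (if a = p then g (keep_index p a, keep_index p b) \<otimes> g (shift_index p a, shift_index p b)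
     else if b = p then g (shift_index p a, shift_index p b) \<otimes> g (keep_index p a, keep_index p b)
     else g (keep_index p a, keep_index p b))"
proof -
  have "g (keep_index p a, keep_index p b) \<in> carrier G"
    "g (shift_index p a, shift_index p b) \<in> carrier G"
    using relabelled_closed[OF assms(1,3-5)] by blast+
  then show ?thesis
    using assms(5)
    by (auto simp: doubled_def double_gen_eq keep_index_self shift_index_self
        keep_index_eq_shift_index simp del: double_gen.simps)
qed

end


section \<open>Cancelling one copy of a doubled relation\<close>

context group
begin

lemma commute_product_cancel:
  assumes "x \<in> carrier G" "x' \<in> carrier G" "y \<in> carrier G"
    and "x \<otimes> y = y \<otimes> x"
  shows "(x \<otimes> x') \<otimes> y = y \<otimes> (x \<otimes> x') \<longleftrightarrow> x' \<otimes> y = y \<otimes> x'"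
    and "(x' \<otimes> x) \<otimes> y = y \<otimes> (x' \<otimes> x) \<longleftrightarrow> x' \<otimes> y = y \<otimes> x'"
proof -
  have "y \<otimes> (x \<otimes> x') = x \<otimes> (y \<otimes> x')" using assms by (simp flip: m_assoc)
  then show "(x \<otimes> x') \<otimes> y = y \<otimes> (x \<otimes> x') \<longleftrightarrow> x' \<otimes> y = y \<otimes> x'"
    using assms(1-3) by (simp add: m_assoc)
  have "(x' \<otimes> x) \<otimes> y = (x' \<otimes> y) \<otimes> x" using assms by (simp add: m_assoc)
  then show "(x' \<otimes> x) \<otimes> y = y \<otimes> (x' \<otimes> x) \<longleftrightarrow> x' \<otimes> y = y \<otimes> x'"
    using assms(1-3) by (simp flip: m_assoc)
qed

text \<open>
  In the next three lemmas \<open>a b c = c b a\<close> is the braid relation with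
  \<open>a = \<lambda>\<^sub>k\<^sub>i\<close>, \<open>b = \<lambda>\<^sub>k\<^sub>j\<close>, \<open>c = \<lambda>\<^sub>i\<^sub>j\<close>; the strand
  \<open>k\<close>, \<open>i\<close> or \<open>j\<close> is doubled, and the primed letters involve its second copy. The
  commutations separate the two copies into adjacent blocks, and the known block is cancelled.
\<close>

lemma braid_product_cancel_k:
  assumes c: "a \<in> carrier G" "a' \<in> carrier G" "b \<in> carrier G" "b' \<in> carrier G" "c \<in> carrier G"
    and braid: "a \<otimes> b \<otimes> c = c \<otimes> b \<otimes> a"
    and comm: "a' \<otimes> b = b \<otimes> a'" "a \<otimes> b' = b' \<otimes> a"
  shows "(a \<otimes> a') \<otimes> (b \<otimes> b') \<otimes> c = c \<otimes> (b \<otimes> b') \<otimes> (a \<otimes> a') \<longleftrightarrow>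
    a' \<otimes> b' \<otimes> c = c \<otimes> b' \<otimes> a'"
proof -
  have "(a \<otimes> a') \<otimes> (b \<otimes> b') \<otimes> c = a \<otimes> (a' \<otimes> b) \<otimes> b' \<otimes> c"
    using c by (simp add: m_assoc)
  also have "\<dots> = (a \<otimes> b) \<otimes> (a' \<otimes> b' \<otimes> c)"
    unfolding comm using c by (simp add: m_assoc)
  finally have left: "(a \<otimes> a') \<otimes> (b \<otimes> b') \<otimes> c = (a \<otimes> b) \<otimes> (a' \<otimes> b' \<otimes> c)" .
  have "c \<otimes> (b \<otimes> b') \<otimes> (a \<otimes> a') = c \<otimes> b \<otimes> (b' \<otimes> a) \<otimes> a'"
    using c by (simp add: m_assoc)
  also have "\<dots> = (c \<otimes> b \<otimes> a) \<otimes> (b' \<otimes> a')"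
    unfolding comm(2)[symmetric] using c by (simp add: m_assoc)
  also have "\<dots> = (a \<otimes> b) \<otimes> (c \<otimes> b' \<otimes> a')"
    unfolding braid[symmetric] using c by (simp add: m_assoc)
  finally show ?thesis unfolding left using c by simp
qed

lemma braid_product_cancel_i:
  assumes c: "a \<in> carrier G" "a' \<in> carrier G" "b \<in> carrier G" "c \<in> carrier G" "c' \<in> carrier G"
    and braid: "a \<otimes> b \<otimes> c = c \<otimes> b \<otimes> a"
    and comm: "a \<otimes> c' = c' \<otimes> a" "a' \<otimes> c = c \<otimes> a'"
  shows "(a' \<otimes> a) \<otimes> b \<otimes> (c \<otimes> c') = (c \<otimes> c') \<otimes> b \<otimes> (a' \<otimes> a) \<longleftrightarrow>
    a' \<otimes> b \<otimes> c' = c' \<otimes> b \<otimes> a'"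
proof -
  have "(a' \<otimes> a) \<otimes> b \<otimes> (c \<otimes> c') = a' \<otimes> (a \<otimes> b \<otimes> c) \<otimes> c'"
    using c by (simp add: m_assoc)
  also have "\<dots> = (a' \<otimes> c) \<otimes> b \<otimes> (a \<otimes> c')"
    unfolding braid using c by (simp add: m_assoc)
  also have "\<dots> = c \<otimes> (a' \<otimes> b \<otimes> c') \<otimes> a"
    unfolding comm using c by (simp add: m_assoc)
  finally have left: "(a' \<otimes> a) \<otimes> b \<otimes> (c \<otimes> c') = c \<otimes> (a' \<otimes> b \<otimes> c') \<otimes> a" .
  have right: "(c \<otimes> c') \<otimes> b \<otimes> (a' \<otimes> a) = c \<otimes> (c' \<otimes> b \<otimes> a') \<otimes> a"
    using c by (simp add: m_assoc)
  show ?thesis unfolding left right using c by simp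
qed

lemma braid_product_cancel_j:
  assumes c: "a \<in> carrier G" "b \<in> carrier G" "b' \<in> carrier G" "c \<in> carrier G" "c' \<in> carrier G"
    and braid: "a \<otimes> b \<otimes> c = c \<otimes> b \<otimes> a"
    and comm: "b \<otimes> c' = c' \<otimes> b" "b' \<otimes> c = c \<otimes> b'"
  shows "a \<otimes> (b' \<otimes> b) \<otimes> (c' \<otimes> c) = (c' \<otimes> c) \<otimes> (b' \<otimes> b) \<otimes> a \<longleftrightarrow>
    a \<otimes> b' \<otimes> c' = c' \<otimes> b' \<otimes> a"
proof -
  have "a \<otimes> (b' \<otimes> b) \<otimes> (c' \<otimes> c) = a \<otimes> b' \<otimes> (b \<otimes> c') \<otimes> c"
    using c by (simp add: m_assoc)
  also have "\<dots> = (a \<otimes> b' \<otimes> c') \<otimes> (b \<otimes> c)"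
    unfolding comm using c by (simp add: m_assoc)
  finally have left: "a \<otimes> (b' \<otimes> b) \<otimes> (c' \<otimes> c) = (a \<otimes> b' \<otimes> c') \<otimes> (b \<otimes> c)" .
  have "(c' \<otimes> c) \<otimes> (b' \<otimes> b) \<otimes> a = c' \<otimes> (c \<otimes> b') \<otimes> (b \<otimes> a)"
    using c by (simp add: m_assoc)
  also have "\<dots> = (c' \<otimes> b') \<otimes> (c \<otimes> b \<otimes> a)"
    unfolding comm(2)[symmetric] using c by (simp add: m_assoc)
  also have "\<dots> = (c' \<otimes> b' \<otimes> a) \<otimes> (b \<otimes> c)"
    unfolding braid[symmetric] using c by (simp add: m_assoc)
  finally show ?thesis unfolding left using c by simp
qed

text \<open>
  At most one of the two letters involves the strand \<open>p\<close>; it becomes a product, and the copy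
  relabelled by \<open>keep_index\<close> can be cancelled.
\<close>

lemma doubled_commuting_iff:
  assumes g: "g \<in> vp_gens (n + 1) \<rightarrow> carrier G" and p: "p \<in> {1..n}"
    and ijkl: "{i, j, k, l} \<subseteq> {1..n}" "distinct [i, j, k, l]"
    and kept: "commuting G g (keep_index p i) (keep_index p j) (keep_index p k) (keep_index p l)"
  shows "commuting G (doubled G g p) i j k l \<longleftrightarrow>
    commuting G g (shift_index p i) (shift_index p j) (shift_index p k) (shift_index p l)"
proof -
  define \<kappa> where "\<kappa> = keep_index p"
  define \<sigma> where "\<sigma> = shift_index p"
  have closed: "g (\<kappa> a, \<kappa> b) \<in> carrier G" "g (\<sigma> a, \<sigma> b) \<in> carrier G"
    if "a \<in> {i, j, k, l}" "b \<in> {i, j, k, l}" "a \<noteq> b" for a b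
    unfolding \<kappa>_def \<sigma>_def using that ijkl(1) by (intro relabelled_closed[OF g]; blast)+
  have eq: "doubled G g p (i, j) = (if i = p then g (\<kappa> i, \<kappa> j) \<otimes> g (\<sigma> i, \<sigma> j)
       else if j = p then g (\<sigma> i, \<sigma> j) \<otimes> g (\<kappa> i, \<kappa> j) else g (\<kappa> i, \<kappa> j))"
    "doubled G g p (k, l) = (if k = p then g (\<kappa> k, \<kappa> l) \<otimes> g (\<sigma> k, \<sigma> l)
       else if l = p then g (\<sigma> k, \<sigma> l) \<otimes> g (\<kappa> k, \<kappa> l) else g (\<kappa> k, \<kappa> l))"
    unfolding \<kappa>_def \<sigma>_def using ijkl by (intro doubled_eq[OF g p]; auto)+
  have same: "\<sigma> x = \<kappa> x" if "x \<noteq> p" for x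
    using that by (simp add: \<kappa>_def \<sigma>_def keep_index_eq_shift_index)
  have carr: "g (\<kappa> i, \<kappa> j) \<in> carrier G" "g (\<sigma> i, \<sigma> j) \<in> carrier G"
    "g (\<kappa> k, \<kappa> l) \<in> carrier G" "g (\<sigma> k, \<sigma> l) \<in> carrier G"
    using ijkl(2) by (auto intro!: closed)
  have kept': "g (\<kappa> i, \<kappa> j) \<otimes> g (\<kappa> k, \<kappa> l) = g (\<kappa> k, \<kappa> l) \<otimes> g (\<kappa> i, \<kappa> j)"
    using kept by (simp add: commuting_def \<kappa>_def)
  note first = commute_product_cancel[OF carr(1,2,3) kept']
    and second = commute_product_cancel[OF carr(3,4,1) kept'[symmetric]]
  consider "p = i" | "p = j" | "p = k" | "p = l" | "p \<notin> {i, j, k, l}" by blast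
  then have "commuting G (doubled G g p) i j k l \<longleftrightarrow> commuting G g (\<sigma> i) (\<sigma> j) (\<sigma> k) (\<sigma> l)"
  proof cases
    case 1
    then have "k \<noteq> p" "l \<noteq> p" using ijkl(2) by auto
    then show ?thesis using first(1) same 1 unfolding commuting_def eq by simp
  next
    case 2
    then have "i \<noteq> p" "k \<noteq> p" "l \<noteq> p" using ijkl(2) by auto
    then show ?thesis using first(2) same 2 unfolding commuting_def eq by simp
  next
    case 3
    then have "i \<noteq> p" "j \<noteq> p" "l \<noteq> p" using ijkl(2) by auto
    then show ?thesis using second(1) same 3 unfolding commuting_def eq by (simp add: eq_commute)
  next
    case 4
    then have "i \<noteq> p" "j \<noteq> p" "k \<noteq> p" using ijkl(2) by auto
    then show ?thesis using second(2) same 4 unfolding commuting_def eq by (simp add: eq_commute)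
  next
    case 5
    then show ?thesis using same unfolding commuting_def eq by auto
  qed
  then show ?thesis by (simp add: \<sigma>_def)
qed

text \<open>
  All commutations on \<open>n + 1\<close> strands are assumed, since those needed to separate the two
  copies have both \<open>p\<close> and \<open>p + 1\<close> among their indices.
\<close>

lemma doubled_braiding_iff:
  assumes g: "g \<in> vp_gens (n + 1) \<rightarrow> carrier G" and p: "p \<in> {1..n}"
    and commuting: "\<And>i j k l. {i, j, k, l} \<subseteq> {1..n + 1} \<Longrightarrow> distinct [i, j, k, l] \<Longrightarrow>
      commuting G g i j k l"
    and ijk: "{i, j, k} \<subseteq> {1..n}" "distinct [i, j, k]"
    and kept: "braiding G g (keep_index p i) (keep_index p j) (keep_index p k)"
  shows "braiding G (doubled G g p) i j k \<longleftrightarrow>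
    braiding G g (shift_index p i) (shift_index p j) (shift_index p k)"
proof -
  define \<kappa> where "\<kappa> = keep_index p"
  define \<sigma> where "\<sigma> = shift_index p"
  have index_range: "\<kappa> i \<in> {1..n + 1}" "\<kappa> j \<in> {1..n + 1}" "\<kappa> k \<in> {1..n + 1}"
    "\<sigma> i \<in> {1..n + 1}" "\<sigma> j \<in> {1..n + 1}" "\<sigma> k \<in> {1..n + 1}"
    unfolding \<kappa>_def \<sigma>_def using ijk(1)
    by (intro keep_index_range shift_index_range; blast)+
  have closed: "g (\<kappa> a, \<kappa> b) \<in> carrier G" "g (\<sigma> a, \<sigma> b) \<in> carrier G"
    if "a \<in> {i, j, k}" "b \<in> {i, j, k}" "a \<noteq> b" for a b
    unfolding \<kappa>_def \<sigma>_def using that ijk(1) by (intro relabelled_closed[OF g]; blast)+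
  have eq: "doubled G g p (a, b) = (if a = p then g (\<kappa> a, \<kappa> b) \<otimes> g (\<sigma> a, \<sigma> b)
       else if b = p then g (\<sigma> a, \<sigma> b) \<otimes> g (\<kappa> a, \<kappa> b) else g (\<kappa> a, \<kappa> b))"
    if "a \<in> {i, j, k}" "b \<in> {i, j, k}" "a \<noteq> b" for a b
    unfolding \<kappa>_def \<sigma>_def using ijk(1) that by (intro doubled_eq[OF g p]; blast)
  have eqs: "doubled G g p (k, i) = (if k = p then g (\<kappa> k, \<kappa> i) \<otimes> g (\<sigma> k, \<sigma> i)
       else if i = p then g (\<sigma> k, \<sigma> i) \<otimes> g (\<kappa> k, \<kappa> i) else g (\<kappa> k, \<kappa> i))"
    "doubled G g p (k, j) = (if k = p then g (\<kappa> k, \<kappa> j) \<otimes> g (\<sigma> k, \<sigma> j)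
       else if j = p then g (\<sigma> k, \<sigma> j) \<otimes> g (\<kappa> k, \<kappa> j) else g (\<kappa> k, \<kappa> j))"
    "doubled G g p (i, j) = (if i = p then g (\<kappa> i, \<kappa> j) \<otimes> g (\<sigma> i, \<sigma> j)
       else if j = p then g (\<sigma> i, \<sigma> j) \<otimes> g (\<kappa> i, \<kappa> j) else g (\<kappa> i, \<kappa> j))"
    using ijk(2) by (intro eq; simp; blast)+
  have same: "\<sigma> x = \<kappa> x" if "x \<noteq> p" for x
    using that by (simp add: \<kappa>_def \<sigma>_def keep_index_eq_shift_index)
  have carr: "g (\<kappa> k, \<kappa> i) \<in> carrier G" "g (\<sigma> k, \<sigma> i) \<in> carrier G"
    "g (\<kappa> k, \<kappa> j) \<in> carrier G" "g (\<sigma> k, \<sigma> j) \<in> carrier G"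
    "g (\<kappa> i, \<kappa> j) \<in> carrier G" "g (\<sigma> i, \<sigma> j) \<in> carrier G"
    using ijk(2) by (auto intro!: closed)
  have kept': "g (\<kappa> k, \<kappa> i) \<otimes> g (\<kappa> k, \<kappa> j) \<otimes> g (\<kappa> i, \<kappa> j) =
      g (\<kappa> i, \<kappa> j) \<otimes> g (\<kappa> k, \<kappa> j) \<otimes> g (\<kappa> k, \<kappa> i)"
    using kept by (simp add: braiding_def \<kappa>_def)
  have comm: "g (a, b) \<otimes> g (c, d) = g (c, d) \<otimes> g (a, b)"
    if "{a, b, c, d} \<subseteq> {1..n + 1}" "distinct [a, b, c, d]" for a b c d
    using commuting[OF that] by (simp add: commuting_def)
  have neq: "\<kappa> x \<noteq> \<kappa> y" "\<sigma> x \<noteq> \<sigma> y" "\<kappa> x \<noteq> \<sigma> y" "\<sigma> x \<noteq> \<kappa> y" if "x \<noteq> y" for x y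
    using that keep_index_neq_shift_index[of x y p] keep_index_neq_shift_index[of y x p]
    by (auto simp: \<kappa>_def \<sigma>_def keep_index_eq_iff shift_index_eq_iff)
  have neq_p: "\<kappa> p \<noteq> \<sigma> p" "\<sigma> p \<noteq> \<kappa> p"
    by (simp_all add: \<kappa>_def \<sigma>_def keep_index_self shift_index_self)
  consider "p = k" | "p = i" | "p = j" | "p \<notin> {i, j, k}" by blast
  then have "braiding G (doubled G g p) i j k \<longleftrightarrow> braiding G g (\<sigma> i) (\<sigma> j) (\<sigma> k)"
  proof cases
    case 1
    then have np: "i \<noteq> p" "j \<noteq> p" "i \<noteq> j" using ijk(2) by auto
    have "g (\<sigma> k, \<sigma> i) \<otimes> g (\<kappa> k, \<kappa> j) = g (\<kappa> k, \<kappa> j) \<otimes> g (\<sigma> k, \<sigma> i)"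
      "g (\<kappa> k, \<kappa> i) \<otimes> g (\<sigma> k, \<sigma> j) = g (\<sigma> k, \<sigma> j) \<otimes> g (\<kappa> k, \<kappa> i)"
      using neq_p[unfolded 1] neq[OF np(1)] neq[OF np(2)] neq[OF np(3)] 1
      by (intro comm insert_subsetI empty_subsetI index_range; simp; fail)+
    from braid_product_cancel_k[OF carr(1-5) kept' this] show ?thesis
      using np same[OF np(1)] same[OF np(2)] 1 unfolding braiding_def eqs by simp
  next
    case 2
    then have np: "k \<noteq> p" "j \<noteq> p" "k \<noteq> j" using ijk(2) by auto
    have "g (\<kappa> k, \<kappa> i) \<otimes> g (\<sigma> i, \<sigma> j) = g (\<sigma> i, \<sigma> j) \<otimes> g (\<kappa> k, \<kappa> i)"
      "g (\<sigma> k, \<sigma> i) \<otimes> g (\<kappa> i, \<kappa> j) = g (\<kappa> i, \<kappa> j) \<otimes> g (\<sigma> k, \<sigma> i)"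
      using neq_p[unfolded 2] neq[OF np(1)] neq[OF np(2)] neq[OF np(3)] 2
      by (intro comm insert_subsetI empty_subsetI index_range; simp; fail)+
    from braid_product_cancel_i[OF carr(1,2,3,5,6) kept' this] show ?thesis
      using np same[OF np(1)] same[OF np(2)] 2 unfolding braiding_def eqs by simp
  next
    case 3
    then have np: "k \<noteq> p" "i \<noteq> p" "k \<noteq> i" using ijk(2) by auto
    have "g (\<kappa> k, \<kappa> j) \<otimes> g (\<sigma> i, \<sigma> j) = g (\<sigma> i, \<sigma> j) \<otimes> g (\<kappa> k, \<kappa> j)"
      "g (\<sigma> k, \<sigma> j) \<otimes> g (\<kappa> i, \<kappa> j) = g (\<kappa> i, \<kappa> j) \<otimes> g (\<sigma> k, \<sigma> j)"
      using neq_p[unfolded 3] neq[OF np(1)] neq[OF np(2)] neq[OF np(3)] 3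
      by (intro comm insert_subsetI empty_subsetI index_range; simp; fail)+
    from braid_product_cancel_j[OF carr(1,3,4,5,6) kept' this] show ?thesis
      using np same[OF np(1)] same[OF np(2)] 3 unfolding braiding_def eqs by simp
  next
    case 4
    then show ?thesis using kept' same unfolding braiding_def eqs by auto
  qed
  then show ?thesis by (simp add: \<sigma>_def)
qed

end


section \<open>Reaching all index tuples\<close>

text \<open>
  If the tuple contains \<open>n + 1\<close>, then it misses some \<open>q\<close> in \<open>{1..n}\<close>, and between the
  two there is a \<open>p\<close> outside the tuple with \<open>p + 1\<close> in it. Moving that entry from \<open>p + 1\<close>
  down to \<open>p\<close> decreases the sum of the entries.
\<close>

lemma distinct_list_shift_induct [consumes 3, case_names base shift]:
  fixes xs :: "nat list"
  assumes "set xs \<subseteq> {1..n + 1}" "distinct xs" "length xs \<le> n"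
    and base: "\<And>ys. length ys = length xs \<Longrightarrow> set ys \<subseteq> {1..n} \<Longrightarrow> distinct ys \<Longrightarrow> P ys"
    and shift: "\<And>p ys. p \<in> {1..n} \<Longrightarrow> length ys = length xs \<Longrightarrow> set ys \<subseteq> {1..n} \<Longrightarrow> distinct ys \<Longrightarrow>
      P (map (keep_index p) ys) \<Longrightarrow> P (map (shift_index p) ys)"
  shows "P xs"
proof -
  have "length zs = length xs \<Longrightarrow> set zs \<subseteq> {1..n + 1} \<Longrightarrow> distinct zs \<Longrightarrow> P zs" for zs
  proof (induction "sum_list zs" arbitrary: zs rule: less_induct)
    case less
    show ?case
    proof (cases "n + 1 \<in> set zs")
      case False
      have "set zs \<subseteq> {1..n}"
      proof
        fix x assume "x \<in> set zs"
        then have "x \<in> {1..n + 1}" "x \<noteq> n + 1" using less.prems(2) False by auto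
        then show "x \<in> {1..n}" by auto
      qed
      then show ?thesis using base less.prems by blast
    next
      case True
      have "card (set zs) < card {1..n + 1}"
        using less.prems assms(3) distinct_card[of zs] by simp
      then obtain q where q: "q \<in> {1..n + 1}" "q \<notin> set zs"
        by (metis card_mono finite_set linorder_not_less subsetI)
      define r where "r = (LEAST x. q < x \<and> x \<in> set zs)"
      have "q < n + 1" using q True by (cases "q = n + 1") auto
      then have r: "q < r" "r \<in> set zs"
        unfolding r_def using LeastI[of "\<lambda>x. q < x \<and> x \<in> set zs" "n + 1"] True by auto
      define p where "p = r - 1"
      have r_eq: "r = Suc p" using r p_def by simp
      have p_notin: "p \<notin> set zs"
      proof
        assume "p \<in> set zs"
        then have "q < p" using q r r_eq by (cases "p = q") auto
        then show False
          using not_less_Least[of p "\<lambda>x. q < x \<and> x \<in> set zs"] \<open>p \<in> set zs\<close> r_eq r_def by auto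
      qed
      have p: "p \<in> {1..n}" using q r r_eq less.prems(2) by auto
      define ys where "ys = map (\<lambda>x. if x < p then x else x - 1) zs"
      have neq_p: "x \<noteq> p" if "x \<in> set zs" for x using that p_notin by auto
      have shift_ys: "map (shift_index p) ys = zs"
        unfolding ys_def map_map o_def
        by (rule map_idI) (use neq_p p in \<open>force simp: shift_index_def\<close>)
      have keep_ys: "map (keep_index p) ys = map (\<lambda>x. if x = Suc p then p else x) zs"
        unfolding ys_def map_map o_def
        by (rule map_cong[OF HOL.refl]) (use neq_p in \<open>force simp: keep_index_def\<close>)
      have ys: "length ys = length xs" "distinct ys"
      proof -
        show "length ys = length xs" using less.prems(1) by (simp add: ys_def)
        have "distinct (map (shift_index p) ys)" unfolding shift_ys by (rule less.prems(3))
        then show "distinct ys" unfolding distinct_map by blast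
      qed
      have ys_range: "set ys \<subseteq> {1..n}"
      proof
        fix y assume "y \<in> set ys"
        then obtain x where "x \<in> set zs" "y = (if x < p then x else x - 1)"
          by (auto simp: ys_def)
        moreover from this have "x \<in> {1..n + 1}" "x \<noteq> p" using less.prems(2) neq_p by auto
        ultimately show "y \<in> {1..n}" using p by auto
      qed
      have "sum_list (map (keep_index p) ys) < sum_list (map (\<lambda>x. x) zs)"
        unfolding keep_ys
        using r r_eq less.prems(3)
        by (simp only: sum_list_distinct_conv_sum_set, intro sum_strict_mono_ex1) auto
      moreover have "set (map (keep_index p) ys) \<subseteq> {1..n + 1}"
        using ys_range keep_index_range unfolding set_map by blast
      moreover have "distinct (map (keep_index p) ys)"
        using ys(2) by (simp add: distinct_map inj_on_def keep_index_eq_iff)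
      ultimately have "P (map (keep_index p) ys)"
        using less.hyps[of "map (keep_index p) ys"] ys(1) by simp
      from shift[OF p ys(1) ys_range ys(2) this] show ?thesis unfolding shift_ys .
    qed
  qed
  then show ?thesis using assms(1,2) by blast
qed


section \<open>The defining relations\<close>

text \<open>
  From left to right, both relabellings of each doubled relation hold, hence so does the doubled
  relation. From right to left, the doubled relations provide the moves of the induction above.
\<close>

lemma (in group) models_vp_rels_Suc_iff:
  assumes n: "n \<ge> 4" and g: "g \<in> vp_gens (n + 1) \<rightarrow> carrier G"
  shows "models G g (vp_rels (n + 1)) \<longleftrightarrow>
    models G g (vp_rels n) \<and> (\<forall>p\<in>{1..n}. models G (doubled G g p) (vp_rels n))"
    (is "?L \<longleftrightarrow> ?R \<and> ?D")
proof -
  have g_n: "g \<in> vp_gens n \<rightarrow> carrier G" using g vp_gens_mono[of n "n + 1"] by auto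
  note large = models_vp_rels_iff[OF g]
    and small = models_vp_rels_iff[OF g_n]
    and double = models_vp_rels_iff[OF doubled_closed[OF g]]
  show ?thesis
  proof
    assume L: ?L
    have comm: "commuting G g i j k l" if "{i, j, k, l} \<subseteq> {1..n + 1}" "distinct [i, j, k, l]" for i j k l
      using L that unfolding large by blast
    have braid: "braiding G g i j k" if "{i, j, k} \<subseteq> {1..n + 1}" "distinct [i, j, k]" for i j k
      using L that unfolding large by blast
    have ?D
    proof
      fix p assume p: "p \<in> {1..n}"
      have "commuting G (doubled G g p) i j k l"
        if ijkl: "{i, j, k, l} \<subseteq> {1..n}" "distinct [i, j, k, l]" for i j k l
      proof (subst doubled_commuting_iff[OF g p ijkl])
        show "commuting G g (keep_index p i) (keep_index p j) (keep_index p k) (keep_index p l)"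
          "commuting G g (shift_index p i) (shift_index p j) (shift_index p k) (shift_index p l)"
          using ijkl
          by (auto intro!: comm keep_index_range shift_index_range
              simp: keep_index_eq_iff shift_index_eq_iff simp del: atLeastAtMost_iff)
      qed
      moreover have "braiding G (doubled G g p) i j k"
        if ijk: "{i, j, k} \<subseteq> {1..n}" "distinct [i, j, k]" for i j k
      proof (subst doubled_braiding_iff[OF g p comm ijk])
        show "braiding G g (keep_index p i) (keep_index p j) (keep_index p k)"
          "braiding G g (shift_index p i) (shift_index p j) (shift_index p k)"
          using ijk
          by (auto intro!: braid keep_index_range shift_index_range
              simp: keep_index_eq_iff shift_index_eq_iff simp del: atLeastAtMost_iff)
      qed auto
      ultimately show "models G (doubled G g p) (vp_rels n)" unfolding double[OF p] by blast
    qed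
    moreover have ?R using L vp_rels_mono[of n "n + 1"] unfolding models_def by auto
    ultimately show "?R \<and> ?D" by blast
  next
    assume RD: "?R \<and> ?D"
    have comm: "commuting G g i j k l"
      if ijkl: "{i, j, k, l} \<subseteq> {1..n + 1}" "distinct [i, j, k, l]" for i j k l
    proof -
      have "set [i, j, k, l] \<subseteq> {1..n + 1}" "distinct [i, j, k, l]" "length [i, j, k, l] \<le> n"
        using ijkl n by auto
      then have "case [i, j, k, l] of [i, j, k, l] \<Rightarrow> commuting G g i j k l | _ \<Rightarrow> True"
      proof (induction rule: distinct_list_shift_induct)
        case (base ys)
        then obtain a b c d where ys: "ys = [a, b, c, d]" by (auto simp: length_Suc_conv)
        with base RD small show ?case by simp
      next
        case (shift p ys)
        then obtain a b c d where ys: "ys = [a, b, c, d]" by (auto simp: length_Suc_conv)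
        have abcd: "{a, b, c, d} \<subseteq> {1..n}" "distinct [a, b, c, d]" using shift ys by auto
        then have "commuting G (doubled G g p) a b c d"
          using RD shift(1) double[OF shift(1)] by blast
        with shift(5) doubled_commuting_iff[OF g shift(1) abcd] show ?case by (simp add: ys)
      qed
      then show ?thesis by simp
    qed
    moreover have "braiding G g i j k"
      if ijk: "{i, j, k} \<subseteq> {1..n + 1}" "distinct [i, j, k]" for i j k
    proof -
      have "set [i, j, k] \<subseteq> {1..n + 1}" "distinct [i, j, k]" "length [i, j, k] \<le> n"
        using ijk n by auto
      then have "case [i, j, k] of [i, j, k] \<Rightarrow> braiding G g i j k | _ \<Rightarrow> True"
      proof (induction rule: distinct_list_shift_induct)
        case (base ys)
        then obtain a b c where ys: "ys = [a, b, c]" by (auto simp: length_Suc_conv)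
        with base RD small show ?case by simp
      next
        case (shift p ys)
        then obtain a b c where ys: "ys = [a, b, c]" by (auto simp: length_Suc_conv)
        have abc: "{a, b, c} \<subseteq> {1..n}" "distinct [a, b, c]" using shift ys by auto
        then have "braiding G (doubled G g p) a b c"
          using RD shift(1) double[OF shift(1)] by blast
        with shift(5) doubled_braiding_iff[OF g shift(1) comm abc] show ?case by (simp add: ys)
      qed
      then show ?thesis by simp
    qed
    ultimately show ?L unfolding large by blast
  qed
qed

theorem theorem4p1:
  fixes n :: nat
  assumes "n \<ge> 4"
  shows "full_defining_relations (VP (n + 1)) (vp_gens (n + 1)) (vp_gen (n + 1))
           (vp_rels n \<union> (\<Union>i\<in>{0..n - 1}. degen_rels i (vp_rels n)))"
proof -
  let ?S = "vp_rels n \<union> (\<Union>i\<in>{0..n - 1}. degen_rels i (vp_rels n))"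
  have strands: "{0..n - 1} = {..<n}" using assms by auto
  have "?S \<subseteq> words (vp_gens (n + 1)) \<times> words (vp_gens (n + 1))"
    using vp_rels_in_words[of "n + 1"] vp_rels_mono[of n "n + 1"] degen_rels_in_words[of _ n]
    unfolding strands by fastforce
  moreover have "models G g (vp_rels (n + 1)) \<longleftrightarrow> models G g ?S"
    if "group G" "g \<in> vp_gens (n + 1) \<rightarrow> carrier G"
    for G :: "(nat \<times> nat) word set monoid" and g
  proof -
    have "(\<forall>p\<in>{1..n}. models G (doubled G g p) (vp_rels n)) \<longleftrightarrow>
        (\<forall>i\<in>{..<n}. models G (doubled G g (i + 1)) (vp_rels n))"
      unfolding image_Suc_lessThan[symmetric] by simp
    then show ?thesis
      using group.models_vp_rels_Suc_iff[OF that(1) assms that(2)]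
        group.models_degen_rels_iff[OF that]
      unfolding models_Un models_UN strands by auto
  qed
  ultimately have "full_defining_relations (presented_group (vp_gens (n + 1)) (vp_rels (n + 1)))
      (vp_gens (n + 1)) (\<lambda>x. word_class (vp_gens (n + 1)) (vp_rels (n + 1)) [(x, True)]) ?S"
    using vp_rels_in_words by (intro full_defining_relations_if_same_models)
  then show ?thesis unfolding VP_def vp_gen_def[abs_def] .
qed

end
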